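(* Let $p^\mu=(p^0,p)$ and $q^\mu=(q^0,q)$ be energy-momentum vectors, let $\Lambda=(\Lambda^\mu_{~\nu})$ be the specific Lorentz transformation associated with $p,q$ given in the context, let $\omega\in\mathbb{S}^2$, and let $a^\mu$ be an arbitrary energy-momentum vector. Then $$\sqrt{-\Big(\frac{\sqrt s}{2}-\Lambda^0_{~\mu}a^\mu\Big)^2+\Big|\frac g2\omega-\Lambda a\Big|^2}\;\ge\;c\,\frac{\big|\frac g2\omega-\Lambda a\big|}{\sqrt{a^0}\,(p^0q^0)^{1/2}},$$ where $\Lambda a\in\mathbb{R}^3$ denotes the vector with components $(\Lambda a)_i=\Lambda^i_{~\mu}a^\mu$, $i=1,2,3$, and $c>0$ is a universal constant (independent of $p,q,\omega,a$).
   Context: The Lorentz product of 4-vectors is $a^\mu b_\mu=-a^0b^0+\sum_{i=1}^3a^ib^i$, and repeated upper/lower indices are summed over $0,1,2,3$. An energy-momentum vector is a 4-vector $a^\mu=(a^0,a)$ with $a^\mu a_\mu=-1$ and $a^0>0$, i.e. $a^0=\sqrt{1+|a|^2}$. Put $s=2(-p^\mu q_\mu+1)$ and $g=\sqrt{(p^\mu-q^\mu)(p_\mu-q_\mu)}$, so $s=g^2+4$. For $p,q\in\mathbb{R}^3$ with $p\times q\ne0$, $\Lambda$ is the Lorentz transformation $$\Lambda=\begin{pmatrix}\frac{p^0+q^0}{\sqrt s}&-\frac{p^1+q^1}{\sqrt s}&-\frac{p^2+q^2}{\sqrt s}&-\frac{p^3+q^3}{\sqrt s}\\ \Lambda^1_{~0}&\Lambda^1_{~1}&\Lambda^1_{~2}&\Lambda^1_{~3}\\0&\frac{(p\times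 q)^1}{|p\times q|}&\frac{(p\times q)^2}{|p\times q|}&\frac{(p\times q)^3}{|p\times q|}\\ \frac{p^0-q^0}{g}&-\frac{p^1-q^1}{g}&-\frac{p^2-q^2}{g}&-\frac{p^3-q^3}{g}\end{pmatrix},$$ where the entry in row $\mu$ and column $\nu$ is $\Lambda^\mu_{~\nu}$ ($\mu,\nu=0,1,2,3$), and $$\Lambda^1_{~0}=\frac{2|p\times q|}{g\sqrt s},\qquad\Lambda^1_{~i}=\frac{2\big(p^i\{p^0+q^0p^\mu q_\mu\}+q^i\{q^0+p^0p^\mu q_\mu\}\big)}{g\sqrt s\,|p\times q|}\quad(i=1,2,3).$$ It satisfies $\Lambda^\kappa_{~\mu}\eta_{\kappa\lambda}\Lambda^\lambda_{~\nu}=\eta_{\mu\nu}$ with $\eta=\mathrm{diag}(-1,1,1,1)$. *)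

theory Defs
  imports "HOL-Analysis.Analysis"
begin

text \<open>
  4-vectors have type \<^typ>\<open>real^4\<close> and are indexed by \<open>0, 1, 2, 3 :: 4\<close>. Numerals of type \<open>4\<close> are
  read modulo 4, so the time index \<open>0\<close> is the same index as \<open>4\<close>. All 4-vectors are given by their
  contravariant (upper index) components; in the matrix of a transformation the entry in row
  \<open>\<mu>\<close> and column \<open>\<nu>\<close> has \<open>\<mu>\<close> up and \<open>\<nu>\<close> down, so that it acts by \<open>*v\<close>.
\<close>

lemma UNIV_4_index: "(UNIV :: 4 set) = {0, 1, 2, 3}"
  by (subst UNIV_4) auto

lemma distinct_4_index [simp]:
  "(1::4) \<noteq> 0" "(2::4) \<noteq> 0" "(3::4) \<noteq> 0" "(2::4) \<noteq> 1" "(3::4) \<noteq> 1" "(3::4) \<noteq> 2"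
  "(0::4) \<noteq> 1" "(0::4) \<noteq> 2" "(0::4) \<noteq> 3" "(1::4) \<noteq> 2" "(1::4) \<noteq> 3" "(2::4) \<noteq> 3"
  by simp_all

definition spatial :: "real^4 \<Rightarrow> real^3" where
  "spatial a = vector [a $ 1, a $ 2, a $ 3]"

definition four :: "real \<Rightarrow> real^3 \<Rightarrow> real^4" where
  "four t x = (\<chi> \<mu>. if \<mu> = 0 then t else if \<mu> = 1 then x $ 1 else if \<mu> = 2 then x $ 2 else x $ 3)"

lemma four_component [simp]:
  "four t x $ 0 = t" "four t x $ 1 = x $ 1" "four t x $ 2 = x $ 2" "four t x $ 3 = x $ 3"
  by (simp_all add: four_def)

lemma spatial_four [simp]: "spatial (four t x) = x"
  by (simp add: spatial_def vec_eq_iff forall_3)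

definition lorentz_product :: "real^4 \<Rightarrow> real^4 \<Rightarrow> real" where
  "lorentz_product a b = - (a $ 0 * b $ 0) + (\<Sum>i\<in>{1, 2, 3}. a $ i * b $ i)"

definition energy_momentum :: "real^4 \<Rightarrow> bool" where
  "energy_momentum a \<longleftrightarrow> lorentz_product a a = - 1 \<and> a $ 0 > 0"

definition s_inv :: "real^4 \<Rightarrow> real^4 \<Rightarrow> real" where
  "s_inv p q = 2 * (- lorentz_product p q + 1)"

definition g_rel :: "real^4 \<Rightarrow> real^4 \<Rightarrow> real" where
  "g_rel p q = sqrt (lorentz_product (p - q) (p - q))"

text \<open>Only meaningful if the spatial parts of \<open>p\<close> and \<open>q\<close> have nonzero cross product; otherwise
  some entries divide by zero.\<close>

definition Lambda :: "real^4 \<Rightarrow> real^4 \<Rightarrow> real^4^4" where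
  "Lambda p q =
    (let s = s_inv p q; g = g_rel p q; n = cross3 (spatial p) (spatial q) in
     \<chi> \<mu>.
       if \<mu> = 0 then
         four ((p $ 0 + q $ 0) / sqrt s) (- ((spatial p + spatial q) /\<^sub>R sqrt s))
       else if \<mu> = 1 then
         four (2 * norm n / (g * sqrt s))
           ((2 / (g * sqrt s * norm n)) *\<^sub>R
             ((p $ 0 + q $ 0 * lorentz_product p q) *\<^sub>R spatial p +
              (q $ 0 + p $ 0 * lorentz_product p q) *\<^sub>R spatial q))
       else if \<mu> = 2 then
         four 0 (n /\<^sub>R norm n)
       else
         four ((p $ 0 - q $ 0) / g) (- ((spatial p - spatial q) /\<^sub>R g)))"

end

theory Submission imports Defs begin

text \<open>
  Both \<open>b = (\<surd>s/2, g \<omega>/2)\<close> and \<open>A = \<Lambda> a\<close> are energy-momentum vectors, and any two such vectors satisfy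
  \<open>|b - A|\<^sup>2 \<le> 2 b\<^sup>0 A\<^sup>0 (b - A)\<^sup>\<mu> (b - A)\<^sub>\<mu>\<close>. The factor \<open>\<surd>s\<close> cancels from \<open>b\<^sup>0 A\<^sup>0\<close>, which equals
  \<open>- (p + q)\<^sup>\<mu> a\<^sub>\<mu> / 2\<close> and is therefore at most \<open>(p\<^sup>0 + q\<^sup>0) a\<^sup>0 \<le> 2 p\<^sup>0 q\<^sup>0 a\<^sup>0\<close>. This gives \<open>c = 1/2\<close>.
\<close>

section \<open>Lorentz products in Euclidean terms\<close>

lemma spatial_component [simp]:
  "spatial a $ 1 = a $ 1" "spatial a $ 2 = a $ 2" "spatial a $ 3 = a $ 3"
  by (simp_all add: spatial_def)

lemma spatial_diff: "spatial (a - b) = spatial a - spatial b"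
  by (simp add: vec_eq_iff forall_3)

lemma lorentz_product_eq_inner:
  "lorentz_product a b = spatial a \<bullet> spatial b - a $ 0 * b $ 0"
  by (simp add: lorentz_product_def inner_vec_def sum_3)

lemma four_inner: "four t x \<bullet> a = t * a $ 0 + x \<bullet> spatial a"
  unfolding inner_vec_def UNIV_4_index by (simp add: sum_3)

section \<open>Inequalities on the mass shell\<close>

lemma energy_momentum_iff:
  "energy_momentum a \<longleftrightarrow> (a $ 0)\<^sup>2 = 1 + (norm (spatial a))\<^sup>2 \<and> a $ 0 > 0"
  unfolding energy_momentum_def lorentz_product_eq_inner dot_square_norm power2_eq_square
  by auto

lemma energy_momentum_time_eq:
  assumes "energy_momentum a"
  shows "(a $ 0)\<^sup>2 = 1 + (norm (spatial a))\<^sup>2"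
  using assms by (simp add: energy_momentum_iff)

lemma energy_momentum_ge_1:
  assumes "energy_momentum a"
  shows "a $ 0 \<ge> 1"
proof -
  have "1\<^sup>2 \<le> (a $ 0)\<^sup>2" using energy_momentum_time_eq[OF assms] by simp
  then show ?thesis by (rule power2_le_imp_le) (use assms in \<open>simp add: energy_momentum_def\<close>)
qed

lemma energy_momentum_norm_less:
  assumes "energy_momentum a"
  shows "norm (spatial a) < a $ 0"
proof (rule power2_less_imp_less)
  show "(norm (spatial a))\<^sup>2 < (a $ 0)\<^sup>2" using energy_momentum_time_eq[OF assms] by simp
  show "0 \<le> a $ 0" using assms by (simp add: energy_momentum_def)
qed

text \<open>Both signs are needed: the upper bound makes the time component of
  \<open>Lambda p q *v a\<close> positive, the lower one bounds that component from above.\<close>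

lemma energy_momentum_abs_inner_less:
  assumes "energy_momentum a" "energy_momentum b"
  shows "\<bar>spatial a \<bullet> spatial b\<bar> < a $ 0 * b $ 0"
proof -
  have "\<bar>spatial a \<bullet> spatial b\<bar> \<le> norm (spatial a) * norm (spatial b)"
    by (rule Cauchy_Schwarz_ineq2)
  also have "\<dots> < a $ 0 * b $ 0"
    using assms energy_momentum_norm_less by (intro mult_strict_mono') auto
  finally show ?thesis .
qed

text \<open>With the notation of the proof, \<open>(X - Y) * (X + Y) = (r - t) * (r + t)\<close> and
  \<open>(r - t)^2 \<le> D\<close>, so \<open>(X - Y)^2\<close> is at most \<open>D\<close> times
  \<open>((r + t) / (X + Y))^2\<close>. That ratio is at most \<open>1 - 1 / (2 * X * Y)\<close>,
  which is \<open>key\<close>.\<close>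

lemma energy_momentum_norm_diff_le:
  assumes x: "energy_momentum x" and y: "energy_momentum y"
  shows "(norm (spatial x - spatial y))\<^sup>2
    \<le> 2 * (x $ 0 * y $ 0) * (- (x $ 0 - y $ 0)\<^sup>2 + (norm (spatial x - spatial y))\<^sup>2)"
proof -
  define X Y r t D where "X = x $ 0" and "Y = y $ 0"
    and "r = norm (spatial x)" and "t = norm (spatial y)"
    and "D = (norm (spatial x - spatial y))\<^sup>2"
  have pos: "X > 0" "Y > 0" and r0: "r \<ge> 0" "t \<ge> 0"
    using x y by (auto simp: X_def Y_def r_def t_def energy_momentum_def)
  have XX: "X\<^sup>2 = 1 + r\<^sup>2" and YY: "Y\<^sup>2 = 1 + t\<^sup>2"
    using energy_momentum_time_eq x y by (auto simp: X_def Y_def r_def t_def)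
  have rX: "r < X" and tY: "t < Y"
    using energy_momentum_norm_less x y by (auto simp: X_def Y_def r_def t_def)
  \<comment> \<open>The distance \<open>X - r\<close> to the light cone is at least
    \<open>1 / (2 * X)\<close>: expand \<open>(X - r)^2 \<ge> 0\<close> and insert
    \<open>r^2 = X^2 - 1\<close>.\<close>
  have gap: "1 \<le> 2 * X * (X - r)" "1 \<le> 2 * Y * (Y - t)"
  proof -
    have "0 \<le> (X - r)\<^sup>2" "0 \<le> (Y - t)\<^sup>2" by simp_all
    then show "1 \<le> 2 * X * (X - r)" "1 \<le> 2 * Y * (Y - t)"
      using XX YY by (simp_all add: power2_eq_square algebra_simps)
  qed
  \<comment> \<open>The target is
    \<open>(X + Y)^2 \<le> 2 * X * Y * ((X + Y)^2 - (r + t)^2)\<close>. The difference of squares is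
    factored; \<open>gap\<close> handles one factor, and the other only exceeds
    \<open>X + Y\<close>.\<close>
  have "(X + Y) * (X + Y) \<le> (X + Y) * (2 * X * Y * (X - r + (Y - t)))"
  proof (rule mult_left_mono)
    have "Y * 1 \<le> Y * (2 * X * (X - r))" "X * 1 \<le> X * (2 * Y * (Y - t))"
      using gap pos by (intro mult_left_mono; simp)+
    then show "X + Y \<le> 2 * X * Y * (X - r + (Y - t))" by (simp add: algebra_simps)
  qed (use pos in simp)
  also have "\<dots> \<le> (X + Y + (r + t)) * (2 * X * Y * (X - r + (Y - t)))"
    using pos r0 rX tY by (intro mult_right_mono) auto
  also have "\<dots> = 2 * X * Y * ((X + Y)\<^sup>2 - (r + t)\<^sup>2)"
    by (simp add: power2_eq_square algebra_simps)
  finally have key: "2 * X * Y * (r + t)\<^sup>2 \<le> (2 * X * Y - 1) * (X + Y)\<^sup>2"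
    by (simp add: power2_eq_square algebra_simps)
  have "(r - t)\<^sup>2 \<le> D"
    unfolding D_def r_def t_def using norm_triangle_ineq3[of "spatial x" "spatial y"]
    by (metis abs_ge_zero power2_abs power_mono)
  then have "(r - t)\<^sup>2 * (r + t)\<^sup>2 \<le> D * (r + t)\<^sup>2" by (rule mult_right_mono) simp
  moreover have "(X - Y)\<^sup>2 * (X + Y)\<^sup>2 = (r - t)\<^sup>2 * (r + t)\<^sup>2"
  proof -
    have "(X - Y) * (X + Y) = (r - t) * (r + t)"
      using XX YY by (simp add: power2_eq_square algebra_simps)
    then show ?thesis by (metis power_mult_distrib)
  qed
  ultimately have "2 * X * Y * ((X - Y)\<^sup>2 * (X + Y)\<^sup>2) \<le> 2 * X * Y * (D * (r + t)\<^sup>2)"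
    using pos by (intro mult_left_mono) auto
  also have "\<dots> = D * (2 * X * Y * (r + t)\<^sup>2)" by simp
  also have "\<dots> \<le> D * ((2 * X * Y - 1) * (X + Y)\<^sup>2)"
    using key by (intro mult_left_mono) (auto simp: D_def)
  finally have "(2 * X * Y * (X - Y)\<^sup>2) * (X + Y)\<^sup>2 \<le> (D * (2 * X * Y - 1)) * (X + Y)\<^sup>2"
    by (simp add: mult.assoc)
  then have "2 * X * Y * (X - Y)\<^sup>2 \<le> D * (2 * X * Y - 1)"
    using pos by (simp add: mult_le_cancel_right zero_less_power2)
  then show ?thesis by (simp add: X_def Y_def D_def algebra_simps)
qed

section \<open>The image of a vector under \<open>Lambda\<close> and its Lorentz norm\<close>

lemma Lambda_mult_component:
  fixes p q a :: "real^4"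
  defines "g \<equiv> g_rel p q" and "s \<equiv> s_inv p q" and "n \<equiv> cross3 (spatial p) (spatial q)"
  shows "(Lambda p q *v a) $ 0
      = ((p $ 0 + q $ 0) * a $ 0 - (spatial p + spatial q) \<bullet> spatial a) / sqrt s"
    and "(Lambda p q *v a) $ 1
      = 2 * norm n / (g * sqrt s) * a $ 0 + 2 / (g * sqrt s * norm n) *
        ((p $ 0 + q $ 0 * lorentz_product p q) * (spatial p \<bullet> spatial a) +
         (q $ 0 + p $ 0 * lorentz_product p q) * (spatial q \<bullet> spatial a))"
    and "(Lambda p q *v a) $ 2 = (n \<bullet> spatial a) / norm n"
    and "(Lambda p q *v a) $ 3
      = ((p $ 0 - q $ 0) * a $ 0 - (spatial p - spatial q) \<bullet> spatial a) / g"
  unfolding matrix_vector_mul_component Lambda_def Let_def g_def s_def n_def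
  by (simp_all add: four_inner inner_add_left divide_inverse algebra_simps)

text \<open>The right-hand side is the Gram determinant of \<open>x, y, z\<close>. It comes from
  \<open>|z x n|^2 = |z|^2 |n|^2 - (z . n)^2\<close> with \<open>n = cross3 x y\<close>, after
  expanding the double cross product.\<close>

lemma inner_cross3_power2:
  fixes x y z :: "real^3"
  shows "(cross3 x y \<bullet> z)\<^sup>2 = (x \<bullet> x) * (y \<bullet> y) * (z \<bullet> z)
    + 2 * (x \<bullet> y) * (x \<bullet> z) * (y \<bullet> z) - (x \<bullet> x) * (y \<bullet> z)\<^sup>2
    - (y \<bullet> y) * (x \<bullet> z)\<^sup>2 - (z \<bullet> z) * (x \<bullet> y)\<^sup>2"
proof -
  have "cross3 z (cross3 x y) = (z \<bullet> y) *\<^sub>R x - (z \<bullet> x) *\<^sub>R y"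
    by (rule Lagrange)
  then have "(cross3 x y \<bullet> z)\<^sup>2
      = (z \<bullet> z) * (norm (cross3 x y))\<^sup>2 - (norm ((z \<bullet> y) *\<^sub>R x - (z \<bullet> x) *\<^sub>R y))\<^sup>2"
    using norm_cross[of z "cross3 x y"] by (simp add: dot_square_norm inner_commute)
  also have "\<dots> = (z \<bullet> z) * ((x \<bullet> x) * (y \<bullet> y) - (x \<bullet> y)\<^sup>2)
      - ((y \<bullet> z)\<^sup>2 * (x \<bullet> x) + (x \<bullet> z)\<^sup>2 * (y \<bullet> y) - 2 * (x \<bullet> z) * (y \<bullet> z) * (x \<bullet> y))"
    unfolding norm_cross unfolding power2_norm_eq_inner
    by (simp add: inner_diff inner_commute power2_eq_square algebra_simps)
  finally show ?thesis by (simp add: algebra_simps)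
qed

text \<open>A nonzero cross product makes Cauchy-Schwarz strict. Adding
  \<open>2 * (p . q) \<le> |p|^2 + |q|^2\<close> gives
  \<open>(1 + p . q)^2 < (1 + |p|^2) * (1 + |q|^2)\<close> for the spatial parts. This keeps
  \<open>g\<close> away from zero.\<close>

lemma lorentz_product_less_neg_1:
  assumes p: "energy_momentum p" and q: "energy_momentum q"
    and n: "cross3 (spatial p) (spatial q) \<noteq> 0"
  shows "lorentz_product p q < - 1"
proof -
  let ?p = "spatial p" and ?q = "spatial q"
  have "0 < (norm (cross3 ?p ?q))\<^sup>2" using n by simp
  then have "(?p \<bullet> ?q)\<^sup>2 < (norm ?p)\<^sup>2 * (norm ?q)\<^sup>2"
    by (simp add: norm_cross power_mult_distrib)
  moreover have "0 \<le> (?p - ?q) \<bullet> (?p - ?q)" by simp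
  then have "2 * (?p \<bullet> ?q) \<le> (norm ?p)\<^sup>2 + (norm ?q)\<^sup>2"
    by (simp add: power2_norm_eq_inner inner_diff inner_commute)
  moreover have "(p $ 0 * q $ 0)\<^sup>2 = (1 + (norm ?p)\<^sup>2) * (1 + (norm ?q)\<^sup>2)"
    using energy_momentum_time_eq p q by (simp add: power_mult_distrib)
  ultimately have "(1 + ?p \<bullet> ?q)\<^sup>2 < (p $ 0 * q $ 0)\<^sup>2"
    by (simp add: power2_eq_square algebra_simps)
  then have "1 + ?p \<bullet> ?q < p $ 0 * q $ 0"
    by (rule power2_less_imp_less) (use p q in \<open>simp add: energy_momentum_def\<close>)
  then show ?thesis by (simp add: lorentz_product_eq_inner)
qed

lemma g_rel_power2:
  assumes p: "energy_momentum p" and q: "energy_momentum q"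
    and n: "cross3 (spatial p) (spatial q) \<noteq> 0"
  shows "(g_rel p q)\<^sup>2 = - 2 - 2 * lorentz_product p q" "g_rel p q > 0"
proof -
  have "lorentz_product (p - q) (p - q)
      = lorentz_product p p + lorentz_product q q - 2 * lorentz_product p q"
    by (simp add: lorentz_product_eq_inner spatial_diff inner_diff inner_commute algebra_simps)
  then have "lorentz_product (p - q) (p - q) = - 2 - 2 * lorentz_product p q"
    using p q by (simp add: energy_momentum_def)
  then show "(g_rel p q)\<^sup>2 = - 2 - 2 * lorentz_product p q" "g_rel p q > 0"
    using lorentz_product_less_neg_1[OF assms] by (simp_all add: g_rel_def)
qed

text \<open>
  Here \<open>P, Q, E\<close> are the energies of \<open>p, q, a\<close>, the values \<open>d, \<alpha>, \<beta>\<close> are the Euclidean products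
  \<open>p \<bullet> q\<close>, \<open>p \<bullet> a\<close>, \<open>q \<bullet> a\<close>, and \<open>L, - x, - y\<close> are the corresponding Lorentz products.
  \<open>M\<close> and \<open>T\<close> are the Gram determinants \<open>|p \<times> q|\<^sup>2\<close> and \<open>((p \<times> q) \<bullet> a)\<^sup>2\<close>, with squared
  norms eliminated by the mass-shell condition. After clearing denominators the identity is
  \<open>(\<Lambda> a)\<^sup>\<mu> (\<Lambda> a)\<^sub>\<mu> = - 1\<close>.
\<close>

lemma lorentz_gram_identity:
  fixes P Q E x y L :: real
  assumes d: "d = L + P * Q" and \<alpha>: "\<alpha> = P * E - x" and \<beta>: "\<beta> = Q * E - y"
    and M: "M = (P\<^sup>2 - 1) * (Q\<^sup>2 - 1) - d\<^sup>2"
    and T: "T = (P\<^sup>2 - 1) * (Q\<^sup>2 - 1) * (E\<^sup>2 - 1) + 2 * d * \<alpha> * \<beta>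
      - (P\<^sup>2 - 1) * \<beta>\<^sup>2 - (Q\<^sup>2 - 1) * \<alpha>\<^sup>2 - (E\<^sup>2 - 1) * d\<^sup>2"
    and K: "K = M * E + (P + Q * L) * \<alpha> + (Q + P * L) * \<beta>"
  shows "M * (x\<^sup>2 + y\<^sup>2 + 2 * L * x * y) + K\<^sup>2 + T * (L\<^sup>2 - 1) = - (M * (L\<^sup>2 - 1))"
proof -
  \<comment> \<open>In \<open>M\<close> the product \<open>P^2 * Q^2\<close> cancels, and then the
    coefficient of \<open>E\<close> in \<open>K\<close> collapses to \<open>1 - L^2\<close>.\<close>
  have M': "M = 1 - P\<^sup>2 - Q\<^sup>2 - 2 * L * P * Q - L\<^sup>2"
    unfolding M d by (simp add: power2_eq_square algebra_simps)
  have K': "K = E * (1 - L\<^sup>2) - (P + Q * L) * x - (Q + P * L) * y"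
    unfolding K M' \<alpha> \<beta> by (simp add: power2_eq_square algebra_simps)
  show ?thesis unfolding K' M' T d \<alpha> \<beta> by (simp add: power2_eq_square algebra_simps)
qed

text \<open>The Lorentz norm of the image is computed directly for the given \<open>a\<close>, in
  place of an entrywise check that the matrix preserves the metric.\<close>

lemma energy_momentum_Lambda:
  assumes p: "energy_momentum p" and q: "energy_momentum q"
    and n: "cross3 (spatial p) (spatial q) \<noteq> 0" and a: "energy_momentum a"
  shows "energy_momentum (Lambda p q *v a)"
proof -
  define g S m where "g = g_rel p q" and "S = sqrt (s_inv p q)"
    and "m = norm (cross3 (spatial p) (spatial q))"
  define P Q E where "P = p $ 0" and "Q = q $ 0" and "E = a $ 0"
  define \<alpha> \<beta> d L where "\<alpha> = spatial p \<bullet> spatial a" and "\<beta> = spatial q \<bullet> spatial a"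
    and "d = spatial p \<bullet> spatial q" and "L = lorentz_product p q"
  define \<tau> K where "\<tau> = cross3 (spatial p) (spatial q) \<bullet> spatial a"
    and "K = m\<^sup>2 * E + (P + Q * L) * \<alpha> + (Q + P * L) * \<beta>"
  have L: "L < - 1" using lorentz_product_less_neg_1[OF p q n] by (simp add: L_def)
  have m: "m > 0" using n by (simp add: m_def)
  have g: "g > 0" "g\<^sup>2 = - 2 - 2 * L"
    using g_rel_power2[OF p q n] by (simp_all add: g_def L_def)
  have S: "S > 0" "S\<^sup>2 = 2 - 2 * L" using L by (simp_all add: S_def s_inv_def L_def)
  have Ld: "L = d - P * Q" by (simp add: L_def d_def P_def Q_def lorentz_product_eq_inner)
  have sq: "spatial p \<bullet> spatial p = P\<^sup>2 - 1" "spatial q \<bullet> spatial q = Q\<^sup>2 - 1"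
    "spatial a \<bullet> spatial a = E\<^sup>2 - 1"
    using energy_momentum_time_eq p q a
    by (simp_all add: P_def Q_def E_def power2_norm_eq_inner)
  have m2: "m\<^sup>2 = (P\<^sup>2 - 1) * (Q\<^sup>2 - 1) - d\<^sup>2"
    using norm_cross[of "spatial p" "spatial q"]
    unfolding m_def d_def power2_norm_eq_inner sq by simp
  have \<tau>2: "\<tau>\<^sup>2 = (P\<^sup>2 - 1) * (Q\<^sup>2 - 1) * (E\<^sup>2 - 1) + 2 * d * \<alpha> * \<beta>
      - (P\<^sup>2 - 1) * \<beta>\<^sup>2 - (Q\<^sup>2 - 1) * \<alpha>\<^sup>2 - (E\<^sup>2 - 1) * d\<^sup>2"
    by (simp add: \<tau>_def inner_cross3_power2 sq \<alpha>_def \<beta>_def d_def)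
  let ?A = "Lambda p q *v a"
  have A0: "?A $ 0 = ((P + Q) * E - (\<alpha> + \<beta>)) / S"
    and A2: "?A $ 2 = \<tau> / m"
    and A3: "?A $ 3 = ((P - Q) * E - (\<alpha> - \<beta>)) / g"
    by (simp_all add: Lambda_mult_component S_def g_def m_def P_def Q_def E_def \<alpha>_def \<beta>_def \<tau>_def
        inner_add_left inner_diff_left)
  have "?A $ 1 = 2 * m / (g * S) * E
      + 2 / (g * S * m) * ((P + Q * L) * \<alpha> + (Q + P * L) * \<beta>)"
    by (simp add: Lambda_mult_component S_def g_def m_def P_def Q_def E_def \<alpha>_def \<beta>_def L_def)
  \<comment> \<open>Over the common denominator \<open>g * S * m\<close>, the numerator of component
    1 is \<open>2 * K\<close>.\<close>
  also have "2 * m / (g * S) * E = 2 / (g * S * m) * (m\<^sup>2 * E)"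
    using m by (simp add: power2_eq_square)
  also have "\<dots> + 2 / (g * S * m) * ((P + Q * L) * \<alpha> + (Q + P * L) * \<beta>) = 2 * K / (g * S * m)"
    unfolding K_def by (simp add: add_divide_distrib distrib_left add.assoc)
  finally have A1: "?A $ 1 = 2 * K / (g * S * m)" .
  \<comment> \<open>\<open>x\<close>, \<open>y\<close>, \<open>u\<close>, \<open>v\<close> are the
    negated Lorentz products of \<open>a\<close> with \<open>p\<close>, \<open>q\<close>,
    \<open>p + q\<close>, \<open>p - q\<close>; so components 0 and 3 are \<open>u / S\<close> and
    \<open>v / g\<close>.\<close>
  define x y u v where "x = P * E - \<alpha>" and "y = Q * E - \<beta>" and "u = x + y" and "v = x - y"
  have uv: "(P + Q) * E - (\<alpha> + \<beta>) = u" "(P - Q) * E - (\<alpha> - \<beta>) = v"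
    by (simp_all add: u_def v_def x_def y_def algebra_simps)
  have "m\<^sup>2 * (x\<^sup>2 + y\<^sup>2 + 2 * L * x * y) + K\<^sup>2 + \<tau>\<^sup>2 * (L\<^sup>2 - 1) = - (m\<^sup>2 * (L\<^sup>2 - 1))"
    by (rule lorentz_gram_identity[OF _ _ _ m2 \<tau>2 K_def]) (simp_all add: Ld x_def y_def)
  \<comment> \<open>Since \<open>g^2 = - 2 * (1 + L)\<close> and \<open>S^2 = 2 * (1 - L)\<close>,
    clearing denominators in the Lorentz norm yields four times the Gram identity.\<close>
  moreover have "- u\<^sup>2 * g\<^sup>2 + v\<^sup>2 * S\<^sup>2 = 4 * (x\<^sup>2 + y\<^sup>2 + 2 * L * x * y)" "S\<^sup>2 * g\<^sup>2 = 4 * (L\<^sup>2 - 1)"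
    unfolding g S u_def v_def by (simp_all add: power2_eq_square algebra_simps)
  ultimately have num: "m\<^sup>2 * (- u\<^sup>2 * g\<^sup>2 + v\<^sup>2 * S\<^sup>2) + 4 * K\<^sup>2 + \<tau>\<^sup>2 * (S\<^sup>2 * g\<^sup>2) = - (m\<^sup>2 * (S\<^sup>2 * g\<^sup>2))"
    by algebra
  have "- (?A $ 0)\<^sup>2 + (?A $ 1)\<^sup>2 + (?A $ 2)\<^sup>2 + (?A $ 3)\<^sup>2
      = (m\<^sup>2 * (- u\<^sup>2 * g\<^sup>2 + v\<^sup>2 * S\<^sup>2) + 4 * K\<^sup>2 + \<tau>\<^sup>2 * (S\<^sup>2 * g\<^sup>2)) / (m\<^sup>2 * (S\<^sup>2 * g\<^sup>2))"
    unfolding A0 A1 A2 A3 uv using m g(1) S(1)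
    by (simp add: power_divide power_mult_distrib add_divide_distrib diff_divide_distrib
        distrib_left right_diff_distrib)
  also have "\<dots> = - 1"
    unfolding num using m g(1) S(1) by simp
  finally have "lorentz_product ?A ?A = - 1"
    by (simp add: lorentz_product_def power2_eq_square)
  moreover have "?A $ 0 > 0"
    using S energy_momentum_abs_inner_less[OF p a] energy_momentum_abs_inner_less[OF q a]
    by (simp add: A0 P_def Q_def E_def \<alpha>_def \<beta>_def algebra_simps)
  ultimately show ?thesis by (simp add: energy_momentum_def)
qed

section \<open>The lower bound, by comparing two points of the mass shell\<close>

theorem lemma3p1:
  "\<exists>c::real. c > 0 \<and>
    (\<forall>(p::real^4) (q::real^4) (\<omega>::real^3) (a::real^4).
      energy_momentum p \<longrightarrow> energy_momentum q \<longrightarrow>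
      cross3 (spatial p) (spatial q) \<noteq> 0 \<longrightarrow>
      \<omega> \<in> sphere 0 1 \<longrightarrow> energy_momentum a \<longrightarrow>
      sqrt (- (sqrt (s_inv p q) / 2 - (Lambda p q *v a) $ 0)\<^sup>2
            + (norm ((g_rel p q / 2) *\<^sub>R \<omega> - spatial (Lambda p q *v a)))\<^sup>2)
      \<ge> c * (norm ((g_rel p q / 2) *\<^sub>R \<omega> - spatial (Lambda p q *v a))
             / (sqrt (a $ 0) * sqrt (p $ 0 * q $ 0))))"
proof (intro exI[of _ "1/2"] conjI allI impI)
  fix p q a :: "real^4" and \<omega> :: "real^3"
  assume p: "energy_momentum p" and q: "energy_momentum q"
    and n: "cross3 (spatial p) (spatial q) \<noteq> 0"
    and \<omega>: "\<omega> \<in> sphere 0 1" and a: "energy_momentum a"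
  define S g A where "S = sqrt (s_inv p q)" and "g = g_rel p q" and "A = Lambda p q *v a"
  define b where "b = four (S / 2) ((g / 2) *\<^sub>R \<omega>)"
  define D G where "D = norm (spatial b - spatial A)"
    and "G = - (b $ 0 - A $ 0)\<^sup>2 + D\<^sup>2"
  have S: "S > 0" "S\<^sup>2 = 2 - 2 * lorentz_product p q"
    using lorentz_product_less_neg_1[OF p q n] by (simp_all add: S_def s_inv_def)
  have g: "g\<^sup>2 = - 2 - 2 * lorentz_product p q" "g > 0"
    using g_rel_power2[OF p q n] by (simp_all add: g_def)
  \<comment> \<open>Since \<open>S^2 = g^2 + 4\<close> and \<open>\<omega>\<close> is a unit vector,
    \<open>(S / 2)^2 = 1 + |(g / 2) \<omega>|^2\<close>.\<close>
  have "energy_momentum b"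
    using \<omega> S g by (simp add: energy_momentum_iff b_def power_divide power_mult_distrib field_simps)
  moreover have A: "energy_momentum A"
    using energy_momentum_Lambda[OF p q n a] by (simp add: A_def)
  ultimately have D: "D\<^sup>2 \<le> 2 * (b $ 0 * A $ 0) * G"
    unfolding D_def G_def by (rule energy_momentum_norm_diff_le)
  have bA: "b $ 0 * A $ 0 > 0"
    using \<open>energy_momentum b\<close> A by (simp add: energy_momentum_def)
  \<comment> \<open>The sign is needed to replace \<open>2 * (b $ 0 * A $ 0)\<close> by a larger
    factor in \<open>D\<close>.\<close>
  have G: "G \<ge> 0"
  proof (rule ccontr)
    assume "\<not> G \<ge> 0"
    then have "2 * (b $ 0 * A $ 0) * G < 0" using bA by (simp add: mult_pos_neg)
    then show False using D by (smt (verit) zero_le_power2)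
  qed
  define N where "N = a $ 0 * (p $ 0 * q $ 0)"
  have N: "N > 0" using p q a by (simp add: N_def energy_momentum_def)
  have "2 * (b $ 0 * A $ 0) = (p $ 0 + q $ 0) * a $ 0 - (spatial p + spatial q) \<bullet> spatial a"
    using S(1) by (simp add: b_def A_def Lambda_mult_component S_def[symmetric])
  also have "\<dots> \<le> 2 * ((p $ 0 + q $ 0) * a $ 0)"
    using energy_momentum_abs_inner_less[OF p a] energy_momentum_abs_inner_less[OF q a]
    by (simp add: inner_add_left algebra_simps)
  also have "\<dots> \<le> 2 * ((2 * (p $ 0 * q $ 0)) * a $ 0)"
  proof -
    have "p $ 0 * 1 \<le> p $ 0 * q $ 0" "1 * q $ 0 \<le> p $ 0 * q $ 0"
      using p q energy_momentum_ge_1 by (intro mult_mono; force simp: energy_momentum_def)+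
    then show ?thesis using a by (simp add: energy_momentum_def)
  qed
  \<comment> \<open>One factor 2 comes from the spatial inner products, the other from
    \<open>p $ 0 + q $ 0 \<le> 2 * (p $ 0 * q $ 0)\<close>; the square root of 4 gives the constant
    \<open>1/2\<close>.\<close>
  finally have "2 * (b $ 0 * A $ 0) \<le> 4 * N" by (simp add: N_def)
  then have "D\<^sup>2 \<le> 4 * N * G" using D G by (meson mult_right_mono order_trans)
  then have "(1 / 2 * (D / sqrt N))\<^sup>2 \<le> G"
    using N by (simp add: power_mult_distrib power_divide field_simps)
  then have "1 / 2 * (D / sqrt N) \<le> sqrt G" by (rule real_le_rsqrt)
  then show "1 / 2 * (norm ((g_rel p q / 2) *\<^sub>R \<omega> - spatial (Lambda p q *v a))
             / (sqrt (a $ 0) * sqrt (p $ 0 * q $ 0)))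
      \<le> sqrt (- (sqrt (s_inv p q) / 2 - (Lambda p q *v a) $ 0)\<^sup>2
            + (norm ((g_rel p q / 2) *\<^sub>R \<omega> - spatial (Lambda p q *v a)))\<^sup>2)"
    by (simp add: D_def G_def N_def b_def A_def S_def g_def real_sqrt_mult)
qed simp

end
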